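(* Let $m,s\ge1$ be integers, let $C_1,\dots,C_s\in\{0,1\}^{m\times m}$, and let $\boldsymbol{x}_0,\dots,\boldsymbol{x}_{2^m-1}\in[0,1)^s$ be the digital net in base $2$ generated by $C_1,\dots,C_s$. Let $u\subseteq\{1,\dots,s\}$ be nonempty and $\boldsymbol{k}\in\mathbb{N}_0^{|u|}$. Then $\Gamma_{u,\boldsymbol{k}}=2^{m-\mathrm{rank}(C_{u,\boldsymbol{k}})}$ if and only if the vector $\sum_{j\in u}C_j(k_j+1,:)\in\{0,1\}^m$ (sum modulo $2$) is in the row space of $C_{u,\boldsymbol{k}}$ over $\mathbb{Z}_2$.
   Context: All matrix and vector arithmetic on bits, and all ranks and row spaces, are over the field $\mathbb{Z}_2$. $\mathbb{N}_0$ is the set of non-negative integers. Digital net: for an integer $0\le i<2^m$ with $i=\sum_{\ell=1}^m i_\ell2^{\ell-1}$, $i_\ell\in\{0,1\}$, let $\vec{i}=(i_1,\dots,i_m)^{\mathsf T}$. The digital net generated by $C_1,\dots,C_s$ is $\boldsymbol{x}_i=(x_{i1},\dots,x_{is})$ with $x_{ij}=\sum_{\ell=1}^m x_{ij\ell}2^{-\ell}$, where $(x_{ij1},\dots,x_{ijm})^{\mathsf T}=C_j\vec{i}$ mod $2$. Matrices: $C_j(\ell,:)$ denotes row $\ell$ of $C_j$, with the convention that $C_j(\ell,:)$ is the zero row of length $m$ for $\ell>m$. For nonempty $u\subseteq\{1,\dots,s\}$ and $\boldsymbol{k}=(k_j)_{j\in u}\in\mathbb{N}_0^{|u|}$, $C_{u,\boldsymbol{k}}$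 is the matrix with $|\boldsymbol{k}|=\sum_{j\in u}k_j$ rows and $m$ columns obtained by stacking the rows $C_j(\ell,:)$, $1\le\ell\le k_j$, for $j\in u$ (the row space of an empty matrix is $\{0\}$). Gain coefficients: let $n=2^m$. For $x,x'\in[0,1)$ let $M(x,x')=\max\{k\in\mathbb{N}_0: \lfloor 2^kx\rfloor=\lfloor 2^kx'\rfloor\}\in\mathbb{N}_0\cup\{\infty\}$ (equal to $\infty$ when $x=x'$). For nonempty $u\subseteq\{1,\dots,s\}$, $\boldsymbol{k}=(k_j)_{j\in u}\in\mathbb{N}_0^{|u|}$, $j\in u$ and $0\le i,i'<n$, put $N_{i,i',j}=0$ if $M(x_{ij},x_{i'j})<k_j$, $-1$ if $M(x_{ij},x_{i'j})=k_j$, and $1$ if $M(x_{ij},x_{i'j})>k_j$. Then $\Gamma_{u,\boldsymbol{k}}=\frac1n\sum_{i=0}^{n-1}\sum_{i'=0}^{n-1}\prod_{j\in u}N_{i,i',j}$. *)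

theory Defs
  imports
    "Jordan_Normal_Form.DL_Rank"
    "HOL-Library.Z2"
    "HOL-Library.Extended_Nat"
    Complex_Main
begin

text \<open>
  Digits, rows and coordinates are numbered from 1; the entries of vectors and matrices of
  Jordan_Normal_Form are numbered from 0, hence the shifts by one below.
  \<^typ>\<open>bit\<close> is the field with two elements, so all vector and matrix arithmetic on it
  is modulo 2.
\<close>

text \<open>The binary digits of \<open>i\<close>, least significant first.\<close>

definition digit_vec :: "nat \<Rightarrow> nat \<Rightarrow> bit vec" where
  "digit_vec m i = vec m (\<lambda>l. of_nat (i div 2 ^ l mod 2))"

definition digital_net :: "nat \<Rightarrow> (nat \<Rightarrow> bit mat) \<Rightarrow> nat \<Rightarrow> nat \<Rightarrow> real" where
  "digital_net m C i j =
     (\<Sum>l = 1..m. of_bit ((C j *\<^sub>v digit_vec m i) $ (l - 1)) / 2 ^ l)"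

definition mrow :: "bit mat \<Rightarrow> nat \<Rightarrow> bit vec" where
  "mrow A l = (if 1 \<le> l \<and> l \<le> dim_row A then row A (l - 1) else 0\<^sub>v (dim_col A))"

text \<open>
  A tuple \<open>(k\<^sub>j)\<close> indexed by \<open>j \<in> u\<close> is a function on the naturals of which
  only the values on \<open>u\<close> are used. The blocks are stacked by increasing \<open>j\<close>.
\<close>

definition stacked_mat :: "nat \<Rightarrow> (nat \<Rightarrow> bit mat) \<Rightarrow> nat set \<Rightarrow> (nat \<Rightarrow> nat) \<Rightarrow> bit mat" where
  "stacked_mat m C u k =
     mat_of_rows m (concat (map (\<lambda>j. map (mrow (C j)) [1..<Suc (k j)]) (sorted_list_of_set u)))"

text \<open>
  The number of common leading binary digits. For distinct points of \<open>[0,1)\<close> the set below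
  is finite and contains 0, so that \<^const>\<open>Max\<close> is a genuine maximum.
\<close>

definition common_digits :: "real \<Rightarrow> real \<Rightarrow> enat" where
  "common_digits x x' =
     (if x = x' then \<infinity> else enat (Max {k. \<lfloor>2 ^ k * x\<rfloor> = \<lfloor>2 ^ k * x'\<rfloor>}))"

definition gain_factor :: "nat \<Rightarrow> real \<Rightarrow> real \<Rightarrow> real" where
  "gain_factor k x x' =
     (if common_digits x x' < enat k then 0
      else if common_digits x x' = enat k then - 1
      else 1)"

definition gain_coeff :: "nat \<Rightarrow> (nat \<Rightarrow> nat \<Rightarrow> real) \<Rightarrow> nat set \<Rightarrow> (nat \<Rightarrow> nat) \<Rightarrow> real" where
  "gain_coeff n x u k =
     1 / real n * (\<Sum>i<n. \<Sum>i'<n. \<Prod>j\<in>u. gain_factor (k j) (x i j) (x i' j))"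

text \<open>
  The library rank is the dimension of the column span and takes the number of rows as a
  parameter.
\<close>

definition mat_rank :: "bit mat \<Rightarrow> nat" where
  "mat_rank A = vec_space.rank (dim_row A) A"

end

theory Submission
  imports Defs
begin

text \<open>
  The gain factor of the points \<open>i\<close> and \<open>i'\<close> in coordinate \<open>j\<close> depends only on the sum \<open>d\<close> of
  their digit vectors: it vanishes unless the first \<open>k j\<close> rows of \<open>C j\<close> are orthogonal to \<open>d\<close>,
  and is otherwise the sign \<open>bit_sign\<close> of the product of row \<open>k j + 1\<close> with \<open>d\<close>. Hence the gain
  coefficient is the sum over \<open>d\<close> in the kernel \<open>K\<close> of the stacked matrix of the character
  \<open>bit_sign (d \<bullet> b)\<close>, where \<open>b\<close> is the sum of the rows \<open>k j + 1\<close>. It equals \<open>card K\<close> if \<open>b\<close> is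
  orthogonal to \<open>K\<close>, and 0 otherwise. Orthogonality of characters also shows that a subspace
  is its own double orthogonal complement, so \<open>b\<close> is orthogonal to \<open>K\<close> iff it lies in the row
  space; counting fibres gives \<open>card K * 2 ^ rank = 2 ^ m\<close>.
\<close>

text \<open>
  These default simplification rules replace the field operations of \<^typ>\<open>bit\<close> by bit operations,
  which blocks the ring lemmas.
\<close>

declare add_bit_eq_xor [simp del] mult_bit_eq_and [simp del]

section \<open>Bits and their signs\<close>

lemma bit_add_self [simp]: "a + a = (0 :: bit)"
  by (cases a) simp_all

lemma bit_add_eq_0_iff: "a + b = 0 \<longleftrightarrow> a = b" for a b :: bit
  by (cases a; cases b) simp_all

lemma finite_UNIV_bit: "finite (UNIV :: bit set)" and card_UNIV_bit: "card (UNIV :: bit set) = 2"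
proof -
  have U: "(UNIV :: bit set) = {0, 1}"
    using bit_not_zero_iff by blast
  show "finite (UNIV :: bit set)" "card (UNIV :: bit set) = 2"
    unfolding U by simp_all
qed

text \<open>The nontrivial additive character of the field with two elements.\<close>

definition bit_sign :: "bit \<Rightarrow> real" where
  "bit_sign a = (if a = 0 then 1 else - 1)"

lemma bit_sign_0 [simp]: "bit_sign 0 = 1"
  by (simp add: bit_sign_def)

lemma bit_sign_1 [simp]: "bit_sign 1 = - 1"
  by (simp add: bit_sign_def)

lemma bit_sign_add: "bit_sign (a + b) = bit_sign a * bit_sign b"
  by (cases a; cases b) simp_all

lemma bit_sign_sum: "bit_sign (sum f S) = (\<Prod>x\<in>S. bit_sign (f x))"
  by (induction S rule: infinite_finite_induct) (simp_all add: bit_sign_add)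

section \<open>Finite binary expansions and the gain factor\<close>

lemma sum_inverse_power_2_tail:
  "(\<Sum>l\<in>{k<..m}. 1 / 2 ^ l) < (1 / 2 ^ k :: real)"
proof (cases "k \<le> m")
  case True
  have "(\<Sum>l\<in>{k<..m}. 1 / 2 ^ l) = (1 / 2 ^ k - 1 / 2 ^ m :: real)"
    using True
  proof (induction m rule: dec_induct)
    case (step n)
    have "{k<..Suc n} = insert (Suc n) {k<..n}"
      using step by auto
    then have "(\<Sum>l\<in>{k<..Suc n}. 1 / 2 ^ l) = 1 / 2 ^ Suc n + (\<Sum>l\<in>{k<..n}. 1 / 2 ^ l :: real)"
      by simp
    also have "\<dots> = 1 / 2 ^ k - 1 / 2 ^ Suc n"
      using step by simp
    finally show ?case .
  qed simp
  also have "\<dots> < 1 / 2 ^ k"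
    by simp
  finally show ?thesis .
qed simp

text \<open>Reads digits \<open>1\<close> to \<open>k\<close>, most significant first, as an
  integer; \<open>a 0\<close> is ignored, since digits are numbered from 1.\<close>

fun digit_prefix :: "(nat \<Rightarrow> bit) \<Rightarrow> nat \<Rightarrow> int" where
  "digit_prefix a 0 = 0"
| "digit_prefix a (Suc k) = 2 * digit_prefix a k + of_bit (a (Suc k))"

text \<open>The parity of a prefix is its last digit and its half is the preceding prefix, so the
  digits can be recovered one at a time.\<close>

lemma digit_prefix_eq_iff:
  "digit_prefix a k = digit_prefix b k \<longleftrightarrow> (\<forall>l\<in>{1..k}. a l = b l)"
proof (induction k)
  case (Suc k)
  have "digit_prefix a (Suc k) = digit_prefix b (Suc k) \<longleftrightarrow>
      digit_prefix a k = digit_prefix b k \<and> a (Suc k) = b (Suc k)"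
    by (cases "a (Suc k)"; cases "b (Suc k)") (simp_all, presburger+)
  then show ?case
    using Suc by (auto simp: atLeastAtMostSuc_conv)
qed simp

lemma digit_prefix_eq_sum:
  "real_of_int (digit_prefix a k) = 2 ^ k * (\<Sum>l\<in>{1..k}. of_bit (a l) / 2 ^ l)"
  by (induction k) (simp_all add: distrib_left)

text \<open>Scaling by \<open>2 ^ k\<close> makes the first \<open>k\<close> digits an integer. The
  later digits contribute strictly less than 1 because the expansion stops at
  \<open>m\<close>.\<close>

lemma floor_digits:
  assumes "\<And>l. l > m \<Longrightarrow> a l = 0"
  shows "\<lfloor>2 ^ k * (\<Sum>l = 1..m. of_bit (a l) / 2 ^ l :: real)\<rfloor> = digit_prefix a k"
proof -
  let ?t = "\<lambda>l. of_bit (a l) / 2 ^ l :: real"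
  \<comment> \<open>Padding with zero digits covers \<open>k > m\<close> as well; the tail is then
    empty.\<close>
  have "(\<Sum>l = 1..m. ?t l) = (\<Sum>l \<in> {1..k} \<union> {k<..m}. ?t l)"
    by (rule sum.mono_neutral_left) (auto simp: assms)
  also have "\<dots> = (\<Sum>l = 1..k. ?t l) + (\<Sum>l\<in>{k<..m}. ?t l)"
    by (rule sum.union_disjoint) auto
  finally have eq: "2 ^ k * (\<Sum>l = 1..m. ?t l) = digit_prefix a k + 2 ^ k * (\<Sum>l\<in>{k<..m}. ?t l)"
    by (simp add: digit_prefix_eq_sum distrib_left)
  have "(\<Sum>l\<in>{k<..m}. ?t l) \<le> (\<Sum>l\<in>{k<..m}. 1 / 2 ^ l)"
    by (rule sum_mono) (simp add: divide_right_mono)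
  also have "\<dots> < 1 / 2 ^ k"
    by (rule sum_inverse_power_2_tail)
  finally have "2 ^ k * (\<Sum>l\<in>{k<..m}. ?t l) < 1"
    by (simp add: field_simps)
  moreover have "0 \<le> 2 ^ k * (\<Sum>l\<in>{k<..m}. ?t l)"
    by (intro mult_nonneg_nonneg sum_nonneg) simp_all
  ultimately show ?thesis
    unfolding eq by (intro floor_unique) simp_all
qed

text \<open>Equality of floors at level \<open>k\<close> means agreement of the first
  \<open>k\<close> digits. Given this agreement, the factor is -1 exactly if the next digits differ.
  For equal points all digits agree, also those after \<open>m\<close>, and the sign is 1.\<close>

lemma gain_factor_digits:
  assumes a: "\<And>l. l > m \<Longrightarrow> a l = 0" and b: "\<And>l. l > m \<Longrightarrow> b l = 0"
    and x: "x = (\<Sum>l = 1..m. of_bit (a l) / 2 ^ l)"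
    and y: "y = (\<Sum>l = 1..m. of_bit (b l) / 2 ^ l)"
  shows "gain_factor k x y =
    of_bool (\<forall>l\<in>{1..k}. a l + b l = 0) * bit_sign (a (k + 1) + b (k + 1))"
proof -
  define P where "P k \<longleftrightarrow> (\<forall>l\<in>{1..k}. a l = b l)" for k
  have floor_eq: "\<lfloor>2 ^ i * x\<rfloor> = \<lfloor>2 ^ i * y\<rfloor> \<longleftrightarrow> P i" for i
    unfolding x y P_def by (simp only: floor_digits[OF a] floor_digits[OF b] digit_prefix_eq_iff)
  have P_Suc: "P (Suc i) \<longleftrightarrow> P i \<and> a (Suc i) = b (Suc i)" for i
    unfolding P_def by (auto simp: atLeastAtMostSuc_conv)
  have P_mono: "P i \<Longrightarrow> j \<le> i \<Longrightarrow> P j" for i j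
    unfolding P_def by auto
  have lt: "common_digits x y < enat k \<longleftrightarrow> \<not> P k"
    and eq: "common_digits x y = enat k \<longleftrightarrow> P k \<and> \<not> P (Suc k)"
  proof -
    have "(common_digits x y < enat k \<longleftrightarrow> \<not> P k) \<and>
        (common_digits x y = enat k \<longleftrightarrow> P k \<and> \<not> P (Suc k))"
    proof (cases "x = y")
      case True
      then have "P i" for i
        using floor_eq by blast
      then show ?thesis
        using True by (simp add: common_digits_def)
    next
      case False
      have not_P: "\<not> P m"
      proof
        assume "P m"
        then have "x = y"
          unfolding x y P_def by (intro sum.cong) auto
        then show False using False by simp
      qed
      define M where "M = Max {i. P i}"
      have "i \<le> m" if "P i" for i
        using not_P P_mono[OF that, of m] by (cases "m \<le> i") auto
      then have fin: "finite {i. P i}"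
        by (auto intro: finite_subset[of _ "{..m}"])
      have "P 0"
        by (simp add: P_def)
      then have "P M"
        using Max_in[OF fin] unfolding M_def by blast
      moreover have "\<not> P (Suc M)"
        using Max_ge[OF fin, of "Suc M"] unfolding M_def by auto
      \<comment> \<open>Agreement is inherited by shorter prefixes, so the maximum describes the
        whole set.\<close>
      ultimately have P_iff: "P i \<longleftrightarrow> i \<le> M" for i
        using P_mono[of M i] P_mono[of i "Suc M"] not_less_eq_eq by blast
      have "common_digits x y = enat M"
        using False by (simp add: common_digits_def floor_eq M_def)
      then show ?thesis
        by (auto simp: P_iff)
    qed
    then show "common_digits x y < enat k \<longleftrightarrow> \<not> P k"
      and "common_digits x y = enat k \<longleftrightarrow> P k \<and> \<not> P (Suc k)" by auto
  qed
  show ?thesis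
    unfolding gain_factor_def lt eq P_Suc bit_add_eq_0_iff P_def[symmetric] bit_sign_def
    by simp
qed

section \<open>Cardinalities of spans and kernels over a finite field\<close>

lemma bij_betw_vec: "bij_betw (vec n) ({..<n} \<rightarrow>\<^sub>E UNIV) (carrier_vec n)"
proof (rule bij_betwI')
  fix f g :: "nat \<Rightarrow> 'a"
  assume f: "f \<in> {..<n} \<rightarrow>\<^sub>E UNIV" and g: "g \<in> {..<n} \<rightarrow>\<^sub>E UNIV"
  show "vec n f = vec n g \<longleftrightarrow> f = g"
  proof
    assume "vec n f = vec n g"
    then have "f i = g i" if "i < n" for i
      using that by (metis index_vec)
    then show "f = g"
      using f g by (intro PiE_ext) auto
  qed simp
next
  fix v :: "'a vec"
  assume "v \<in> carrier_vec n"
  then have "v = vec n (restrict (($) v) {..<n})"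
    by (intro eq_vecI) auto
  then show "\<exists>f\<in>{..<n} \<rightarrow>\<^sub>E UNIV. v = vec n f"
    by (metis restrict_PiE_iff UNIV_I)
qed simp

lemma card_carrier_vec: "card (carrier_vec n :: 'a vec set) = card (UNIV :: 'a set) ^ n"
  using bij_betw_same_card[OF bij_betw_vec[where ?'a = 'a and n = n]] by (simp add: card_PiE)

lemma finite_carrier_vec:
  assumes "finite (UNIV :: 'a set)"
  shows "finite (carrier_vec n :: 'a vec set)"
  using bij_betw_finite[OF bij_betw_vec[where ?'a = 'a and n = n]] assms
  by (simp add: finite_PiE)

context vec_space
begin

text \<open>Coordinates with respect to \<open>B\<close> are unique. Extensional coefficient
  functions make this a bijection with the span.\<close>

lemma card_span_lin_indpt:
  assumes B: "finite B" "B \<subseteq> carrier_vec n" "lin_indpt B"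
  shows "card (span B) = card (UNIV :: 'a set) ^ card B"
proof -
  have "inj_on (\<lambda>c. lincomb c B) (B \<rightarrow>\<^sub>E UNIV)"
  proof (rule inj_onI)
    fix c d
    assume c: "c \<in> B \<rightarrow>\<^sub>E UNIV" and d: "d \<in> B \<rightarrow>\<^sub>E UNIV" and eq: "lincomb c B = lincomb d B"
    have "lincomb (\<lambda>v. c v - d v) B = 0\<^sub>v n"
      using B eq lincomb_closed[of B] by (simp add: lincomb_diff M.r_neg M.minus_eq)
    then have "c v = d v" if "v \<in> B" for v
      using not_lindepD[OF B(3,1) subset_refl, of "\<lambda>v. c v - d v"] that by auto
    then show "c = d"
      using c d by (intro PiE_ext) auto
  qed
  moreover have "(\<lambda>c. lincomb c B) ` (B \<rightarrow>\<^sub>E UNIV) = span B"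
  proof -
    have "lincomb c B = lincomb (restrict c B) B" for c
      using B by (intro lincomb_cong) auto
    moreover have "restrict c B \<in> B \<rightarrow>\<^sub>E UNIV" for c :: "'a vec \<Rightarrow> 'a"
      by simp
    ultimately show ?thesis
      unfolding finite_span[OF B(1,2)] by blast
  qed
  ultimately have "card (span B) = card (B \<rightarrow>\<^sub>E (UNIV :: 'a set))"
    by (metis card_image)
  then show ?thesis
    using B by (simp add: card_PiE)
qed

lemma card_col_space:
  assumes A: "A \<in> carrier_mat n nc"
  shows "card (col_space A) = card (UNIV :: 'a set) ^ rank A"
proof -
  let ?S = "set (cols A)"
  have S: "?S \<subseteq> carrier_vec n"
    using A cols_dim by blast
  have sub: "submodule class_ring (span ?S) V"
    using span_is_submodule[OF S] .
  \<comment> \<open>\<open>rank\<close> is the dimension of the span as a vector space of its own,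
    so a basis is chosen there and then transferred to the ambient space.\<close>
  interpret W: vectorspace class_ring "span_vs ?S"
    using S span_is_subspace subspace_is_vs by blast
  have "W.fin_dim"
    using S fin_dim_span[of ?S] by simp
  then obtain B where "finite B" "W.basis B"
    using W.finite_basis_exists by blast
  then have dim: "W.dim = card B"
    using W.dim_basis by blast
  have BW: "B \<subseteq> span ?S" and li: "W.lin_indpt B" and gen: "W.span B = span ?S"
    using \<open>W.basis B\<close> by (auto simp: W.basis_def)
  have "span B = span ?S" and "lin_indpt B"
    using span_li_not_depend[OF BW sub] li gen by auto
  moreover have "B \<subseteq> carrier_vec n"
    using BW span_closed[OF S] by blast
  ultimately show ?thesis
    using card_span_lin_indpt[OF \<open>finite B\<close>] dim by (simp add: col_space_def rank_def)
qed

text \<open>Rank-nullity in counting form: the fibre over each point of the column space is a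
  translate of the kernel by a chosen preimage.\<close>

lemma card_kernel_mult_card_col_space:
  assumes "finite (UNIV :: 'a set)" and A: "A \<in> carrier_mat n nc"
  shows "card {x \<in> carrier_vec nc. A *\<^sub>v x = 0\<^sub>v n} * card (col_space A) = card (UNIV :: 'a set) ^ nc"
proof -
  let ?V = "carrier_vec nc :: 'a vec set" and ?K = "{x \<in> carrier_vec nc. A *\<^sub>v x = 0\<^sub>v n}"
  have fin: "finite ?V"
    by (rule finite_carrier_vec) fact
  have image: "(\<lambda>x. A *\<^sub>v x) ` ?V = col_space A"
    using A unfolding col_space_eq[OF A] by auto
  have "card {x \<in> ?V. A *\<^sub>v x = y} = card ?K" if "y \<in> col_space A" for y
  proof -
    have "y \<in> (\<lambda>x. A *\<^sub>v x) ` ?V"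
      unfolding image by fact
    then obtain x0 where x0: "x0 \<in> ?V" "A *\<^sub>v x0 = y"
      by blast
    have "bij_betw (\<lambda>x. x0 + x) ?K {x \<in> ?V. A *\<^sub>v x = y}"
    proof (rule bij_betwI[where g = "\<lambda>x. x - x0"])
      show "(\<lambda>x. x0 + x) \<in> ?K \<rightarrow> {x \<in> ?V. A *\<^sub>v x = y}"
        using x0 A by (auto simp: mult_add_distrib_mat_vec)
      show "(\<lambda>x. x - x0) \<in> {x \<in> ?V. A *\<^sub>v x = y} \<rightarrow> ?K"
        using x0 A by (auto simp: mult_minus_distrib_mat_vec)
    qed (use x0 in auto)
    then show ?thesis
      by (simp add: bij_betw_same_card)
  qed
  then have "card ?V = card ?K * card (col_space A)"
    using sum.image_gen[OF fin, of "\<lambda>_. 1 :: nat" "\<lambda>x. A *\<^sub>v x"] by (simp add: image)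
  then show ?thesis
    by (simp add: card_carrier_vec)
qed

end

section \<open>Character sums and orthogonal complements\<close>

lemma bit_vec_add_add_self:
  assumes "v \<in> carrier_vec m" "w \<in> carrier_vec m"
  shows "v + (v + w) = (w :: bit vec)"
  using assms by (intro eq_vecI) (auto simp flip: add.assoc)

text \<open>If some \<open>g\<close> in \<open>G\<close> has product 1 with \<open>b\<close>,
  translation by \<open>g\<close> is an involution of \<open>G\<close> that flips every sign, so the
  sum equals its own negative.\<close>

lemma sum_bit_sign_scalar_prod:
  assumes G: "G \<subseteq> carrier_vec m" "\<And>v w. v \<in> G \<Longrightarrow> w \<in> G \<Longrightarrow> v + w \<in> G"
    and b: "b \<in> carrier_vec m"
  shows "(\<Sum>v\<in>G. bit_sign (v \<bullet> b)) = of_bool (\<forall>v\<in>G. v \<bullet> b = 0) * real (card G)"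
proof (cases "\<forall>v\<in>G. v \<bullet> b = 0")
  case False
  then obtain g where g: "g \<in> G" "g \<bullet> b = 1"
    by auto
  have "(\<Sum>v\<in>G. bit_sign (v \<bullet> b)) = (\<Sum>v\<in>G. bit_sign ((g + v) \<bullet> b))"
    by (rule sum.reindex_bij_witness[where i = "\<lambda>v. g + v" and j = "\<lambda>v. g + v"])
      (use g G in \<open>auto simp: bit_vec_add_add_self[of _ m] subset_iff\<close>)
  also have "\<dots> = (\<Sum>v\<in>G. - bit_sign (v \<bullet> b))"
    using g G b by (intro sum.cong) (auto simp: add_scalar_prod_distrib[of _ m] subset_iff bit_sign_add)
  finally show ?thesis
    using False by (simp add: sum_negf)
qed simp

text \<open>Sum \<open>bit_sign (g \<bullet> v)\<close> over all \<open>g\<close> in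
  \<open>G\<close> and all vectors \<open>v\<close>, in both orders. The sum over \<open>g\<close>
  is \<open>card G\<close> on the complement and 0 elsewhere; the sum over \<open>v\<close> is
  \<open>2 ^ m\<close> at the zero vector and 0 elsewhere. Closure under addition and containing
  zero suffice for a subspace, the only scalars being 0 and 1.\<close>

lemma card_mult_card_orthogonal_complement:
  fixes G :: "bit vec set"
  assumes G: "G \<subseteq> carrier_vec m" "\<And>v w. v \<in> G \<Longrightarrow> w \<in> G \<Longrightarrow> v + w \<in> G" and "0\<^sub>v m \<in> G"
  shows "card G * card (vec_module.orthogonal_complement m G) = (2 :: nat) ^ m"
proof -
  interpret vec_space "TYPE(bit)" m .
  let ?V = "carrier_vec m :: bit vec set" and ?P = "orthogonal_complement G"
  have card_V: "card ?V = 2 ^ m"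
    by (simp add: card_carrier_vec card_UNIV_bit)
  have finV: "finite ?V"
    by (rule finite_carrier_vec) (rule finite_UNIV_bit)
  have finG: "finite G"
    using finV G(1) by (rule rev_finite_subset)
  have P: "?P = {v \<in> ?V. \<forall>g\<in>G. g \<bullet> v = 0}"
    unfolding orthogonal_complement_def using G(1) by (auto simp: comm_scalar_prod[of _ m] subset_iff)
  have zero_iff: "(\<forall>v\<in>?V. v \<bullet> g = 0) \<longleftrightarrow> g = 0\<^sub>v m" if "g \<in> ?V" for g
  proof
    assume orth: "\<forall>v\<in>?V. v \<bullet> g = 0"
    have "g $ i = 0" if "i < m" for i
      using bspec[OF orth, of "unit_vec m i"] \<open>g \<in> ?V\<close> that by simp
    then show "g = 0\<^sub>v m"
      using that by (intro eq_vecI) auto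
  qed simp
  have "real (card G * card ?P) = (\<Sum>v\<in>?P. real (card G))"
    by simp
  also have "\<dots> = (\<Sum>v\<in>?V. of_bool (v \<in> ?P) * real (card G))"
    using finV by (intro sum.mono_neutral_cong_left) (auto simp: P)
  also have "\<dots> = (\<Sum>v\<in>?V. \<Sum>g\<in>G. bit_sign (g \<bullet> v))"
    using G by (intro sum.cong) (auto simp: sum_bit_sign_scalar_prod P)
  also have "\<dots> = (\<Sum>g\<in>G. \<Sum>v\<in>?V. bit_sign (v \<bullet> g))"
    using G(1) by (subst sum.swap) (auto intro!: sum.cong simp: comm_scalar_prod[of _ m] subset_iff)
  also have "\<dots> = (\<Sum>g\<in>G. of_bool (g = 0\<^sub>v m) * 2 ^ m)"
  proof (rule sum.cong)
    fix g assume "g \<in> G"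
    then have "g \<in> ?V" using G(1) by auto
    then show "(\<Sum>v\<in>?V. bit_sign (v \<bullet> g)) = of_bool (g = 0\<^sub>v m) * 2 ^ m"
      using sum_bit_sign_scalar_prod[of ?V m g] by (simp add: zero_iff card_V)
  qed simp
  also have "\<dots> = 2 ^ m"
    by (simp add: sum.remove[OF finG \<open>0\<^sub>v m \<in> G\<close>])
  finally have "real (card G * card ?P) = real (2 ^ m)"
    by simp
  then show ?thesis
    by (simp only: of_nat_eq_iff)
qed

text \<open>One inclusion is symmetry of the scalar product. The product formula, applied to
  \<open>G\<close> and to its complement, gives both sides the same finite cardinality.\<close>

lemma orthogonal_complement_twice:
  fixes G :: "bit vec set"
  assumes G: "G \<subseteq> carrier_vec m" "\<And>v w. v \<in> G \<Longrightarrow> w \<in> G \<Longrightarrow> v + w \<in> G" and "0\<^sub>v m \<in> G"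
  shows "vec_module.orthogonal_complement m (vec_module.orthogonal_complement m G) = G"
proof -
  interpret vec_space "TYPE(bit)" m .
  let ?P = "orthogonal_complement G"
  have P: "?P \<subseteq> carrier_vec m" "0\<^sub>v m \<in> ?P"
    and P_add: "\<And>v w. v \<in> ?P \<Longrightarrow> w \<in> ?P \<Longrightarrow> v + w \<in> ?P"
    using G(1) by (auto simp: orthogonal_complement_def add_scalar_prod_distrib[of _ m] subset_iff)
  have sub: "G \<subseteq> orthogonal_complement ?P"
    using G(1) by (auto simp: orthogonal_complement_def comm_scalar_prod[of _ m] subset_iff)
  have eq: "card G * card ?P = 2 ^ m" "card ?P * card (orthogonal_complement ?P) = 2 ^ m"
    using card_mult_card_orthogonal_complement G \<open>0\<^sub>v m \<in> G\<close> P P_add by blast+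
  then have "card ?P \<noteq> 0"
    by (metis mult_0 power_not_zero mult.commute zero_neq_numeral)
  with eq have "card G = card (orthogonal_complement ?P)"
    by (metis mult.commute mult_left_cancel)
  moreover have "finite (orthogonal_complement ?P)"
    by (rule finite_subset[OF _ finite_carrier_vec[OF finite_UNIV_bit, of m]])
      (auto simp: orthogonal_complement_def)
  ultimately show ?thesis
    using card_subset_eq sub by metis
qed

section \<open>Digit vectors, matrix rows and points of the net\<close>

lemma digit_vec_carrier [simp]: "digit_vec m i \<in> carrier_vec m"
  by (simp add: digit_vec_def)

text \<open>Numbers below \<open>2 ^ m\<close> are determined by their lowest \<open>m\<close> bits;
  surjectivity then follows by counting.\<close>

lemma bij_betw_digit_vec: "bij_betw (digit_vec m) {..<2 ^ m} (carrier_vec m)"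
proof -
  have "inj_on (digit_vec m) {..<2 ^ m}"
  proof (rule inj_onI)
    fix i j
    assume i: "i \<in> {..<2 ^ m}" and j: "j \<in> {..<2 ^ m}" and eq: "digit_vec m i = digit_vec m j"
    have "bit i l = bit j l" if "l < m" for l
    proof -
      have "digit_vec m i $ l = digit_vec m j $ l"
        using eq by simp
      then have "(of_nat (i div 2 ^ l mod 2) :: bit) = of_nat (j div 2 ^ l mod 2)"
        using that by (simp add: digit_vec_def)
      then show ?thesis
        by (auto simp: bit_iff_odd mod_2_eq_odd split: if_splits)
    qed
    then have "take_bit m i = take_bit m j"
      by (intro bit_eqI) (auto simp: bit_take_bit_iff)
    then show "i = j"
      using i j by (simp add: take_bit_nat_eq_self)
  qed
  moreover have "card (digit_vec m ` {..<2 ^ m}) = card (carrier_vec m :: bit vec set)"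
    using calculation by (simp add: card_image card_carrier_vec card_UNIV_bit)
  then have "digit_vec m ` {..<2 ^ m} = carrier_vec m"
    by (intro card_subset_eq finite_carrier_vec finite_UNIV_bit) auto
  ultimately show ?thesis
    by (simp add: bij_betw_def)
qed

lemma mrow_carrier:
  assumes "A \<in> carrier_mat nr nc"
  shows "mrow A l \<in> carrier_vec nc"
  using assms by (auto simp: mrow_def)

lemma stacked_mat_carrier: "stacked_mat m C u k \<in> carrier_mat (dim_row (stacked_mat m C u k)) m"
  by (rule carrier_matI) (simp_all add: stacked_mat_def)

lemma set_rows_stacked_mat:
  assumes "finite u" and "\<And>j. j \<in> u \<Longrightarrow> C j \<in> carrier_mat m m"
  shows "set (rows (stacked_mat m C u k)) = (\<Union>j\<in>u. mrow (C j) ` {1..k j})"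
proof -
  let ?rs = "concat (map (\<lambda>j. map (mrow (C j)) [1..<Suc (k j)]) (sorted_list_of_set u))"
  have set_rs: "set ?rs = (\<Union>j\<in>u. mrow (C j) ` {1..k j})"
    using assms(1) by (auto simp: atLeastLessThanSuc_atLeastAtMost simp del: upt_Suc)
  also have "\<dots> \<subseteq> carrier_vec m"
    using assms(2) by (fastforce simp: mrow_def)
  finally show ?thesis
    unfolding stacked_mat_def using set_rs by (simp only: rows_mat_of_rows)
qed

lemma gain_factor_digital_net:
  assumes C: "C j \<in> carrier_mat m m"
  shows "gain_factor k (digital_net m C i j) (digital_net m C i' j) =
    of_bool (\<forall>l\<in>{1..k}. mrow (C j) l \<bullet> (digit_vec m i + digit_vec m i') = 0) *
    bit_sign (mrow (C j) (k + 1) \<bullet> (digit_vec m i + digit_vec m i'))"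
proof -
  have digit: "digital_net m C i j = (\<Sum>l = 1..m. of_bit (mrow (C j) l \<bullet> digit_vec m i) / 2 ^ l)" for i
    unfolding digital_net_def using C by (intro sum.cong) (auto simp: mrow_def)
  \<comment> \<open>The zero-row convention matches the zero digits after position \<open>m\<close>,
    so \<open>k \<ge> m\<close> needs no separate case.\<close>
  have zero: "mrow (C j) l \<bullet> digit_vec m i = 0" if "l > m" for l i
    using C that by (auto simp: mrow_def)
  have add: "mrow (C j) l \<bullet> (digit_vec m i + digit_vec m i') =
      mrow (C j) l \<bullet> digit_vec m i + mrow (C j) l \<bullet> digit_vec m i'" for l
    by (rule scalar_prod_add_distrib) (use C mrow_carrier in auto)
  show ?thesis
    unfolding add by (rule gain_factor_digits[OF zero zero digit digit])
qed

text \<open>For each fixed \<open>v\<close>, translation by \<open>v\<close> permutes the vectors,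
  so the inner sum does not depend on \<open>v\<close>.\<close>

lemma sum_carrier_vec_add:
  fixes f :: "bit vec \<Rightarrow> real"
  shows "(\<Sum>v\<in>carrier_vec m. \<Sum>w\<in>carrier_vec m. f (v + w)) = 2 ^ m * (\<Sum>v\<in>carrier_vec m. f v)"
proof -
  have "(\<Sum>w\<in>carrier_vec m. f (v + w)) = (\<Sum>w\<in>carrier_vec m. f w)" if "v \<in> carrier_vec m" for v
    by (rule sum.reindex_bij_witness[where i = "\<lambda>w. v + w" and j = "\<lambda>w. v + w"])
      (use that in \<open>auto simp: bit_vec_add_add_self[of _ m]\<close>)
  then show ?thesis
    by (simp add: card_carrier_vec card_UNIV_bit)
qed

lemma prod_of_bool: "finite S \<Longrightarrow> (\<Prod>x\<in>S. of_bool (P x)) = (of_bool (\<forall>x\<in>S. P x) :: 'a :: comm_semiring_1)"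
  by (induction S rule: finite_induct) auto

section \<open>Evaluation of the gain coefficient\<close>

theorem corollary4:
  fixes m s :: nat
    and C :: "nat \<Rightarrow> bit mat"
    and u :: "nat set"
    and k :: "nat \<Rightarrow> nat"
  assumes "m \<ge> 1"
    and "s \<ge> 1"
    and "\<And>j. j \<in> {1..s} \<Longrightarrow> C j \<in> carrier_mat m m"
    and "u \<subseteq> {1..s}"
    and "u \<noteq> {}"
  shows "gain_coeff (2 ^ m) (digital_net m C) u k
           = 2 powi (int m - int (mat_rank (stacked_mat m C u k)))
         \<longleftrightarrow> finsum_vec TYPE(bit) m (\<lambda>j. mrow (C j) (k j + 1)) u
               \<in> vec_space.row_space m (stacked_mat m C u k)"
proof -
  interpret vec_space "TYPE(bit)" m .
  define A where "A = stacked_mat m C u k"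
  define nr where "nr = dim_row A"
  define R where "R = row_space A"
  define K where "K = orthogonal_complement R"
  define b where "b = finsum_vec TYPE(bit) m (\<lambda>j. mrow (C j) (k j + 1)) u"
  let ?V = "carrier_vec m :: bit vec set"
  have C: "C j \<in> carrier_mat m m" if "j \<in> u" for j
    using assms that by blast
  have u: "finite u"
    using assms(4) finite_subset by blast
  have mrow: "mrow (C j) l \<in> ?V" if "j \<in> u" for j l
    using C[OF that] by (rule mrow_carrier)
  have A: "A \<in> carrier_mat nr m"
    unfolding nr_def A_def by (rule stacked_mat_carrier)
  have rows: "set (rows A) = (\<Union>j\<in>u. mrow (C j) ` {1..k j})"
    unfolding A_def using u C by (rule set_rows_stacked_mat)
  have rows_sub: "set (rows A) \<subseteq> ?V"
    using rows_carrier A by blast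
  \<comment> \<open>Orthogonality to a span need only be tested on its generators.\<close>
  have K_rows: "K = {d \<in> ?V. \<forall>r\<in>set (rows A). r \<bullet> d = 0}"
    unfolding K_def R_def row_space_def in_orthogonal_complement_span[OF rows_sub]
    using rows_sub by (auto simp: orthogonal_complement_def comm_scalar_prod[of _ m] subset_iff)
  have K_add: "v + w \<in> K" if "v \<in> K" "w \<in> K" for v w
    using that rows_sub unfolding K_rows by (auto simp: scalar_prod_add_distrib[of _ m] subset_iff)
  have K_sub: "K \<subseteq> ?V"
    by (auto simp: K_rows)
  have finV: "finite ?V"
    by (rule finite_carrier_vec) (rule finite_UNIV_bit)
  have R: "R \<subseteq> ?V" "0\<^sub>v m \<in> R" "\<And>v w. v \<in> R \<Longrightarrow> w \<in> R \<Longrightarrow> v + w \<in> R"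
    using span_is_submodule[OF rows_sub] unfolding R_def row_space_def submodule_def by auto
  have b: "b \<in> ?V"
    unfolding b_def by (rule finsum_vec_closed) (auto simp: mrow)
  have in_R: "b \<in> R \<longleftrightarrow> (\<forall>v\<in>K. v \<bullet> b = 0)"
  proof -
    have "b \<in> R \<longleftrightarrow> b \<in> orthogonal_complement K"
      unfolding K_def using orthogonal_complement_twice[of R m] R by simp
    then show ?thesis
      using b K_sub by (auto simp: orthogonal_complement_def comm_scalar_prod[of _ m] subset_iff)
  qed
  define g where "g d = of_bool (d \<in> K) * bit_sign (d \<bullet> b)" for d
  have factors: "(\<Prod>j\<in>u. gain_factor (k j) (digital_net m C i j) (digital_net m C i' j)) =
      g (digit_vec m i + digit_vec m i')" for i i'
  proof -
    let ?d = "digit_vec m i + digit_vec m i'"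
    have d: "?d \<in> ?V"
      by simp
    have "?d \<bullet> b = b \<bullet> ?d"
      using b d by (rule comm_scalar_prod[rotated])
    also have "\<dots> = (\<Sum>j\<in>u. mrow (C j) (k j + 1) \<bullet> ?d)"
      unfolding b_def finsum_vec using mrow d by (intro finsum_scalar_prod_sum) auto
    finally have "bit_sign (?d \<bullet> b) = (\<Prod>j\<in>u. bit_sign (mrow (C j) (k j + 1) \<bullet> ?d))"
      by (simp add: bit_sign_sum)
    moreover have "?d \<in> K \<longleftrightarrow> (\<forall>j\<in>u. \<forall>l\<in>{1..k j}. mrow (C j) l \<bullet> ?d = 0)"
      unfolding K_rows rows using d by blast
    ultimately show ?thesis
      unfolding g_def using u
      by (simp add: gain_factor_digital_net C prod.distrib prod_of_bool cong: prod.cong)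
  qed
  have "(\<Sum>i<2 ^ m. \<Sum>i'<2 ^ m. g (digit_vec m i + digit_vec m i')) =
      (\<Sum>v\<in>?V. \<Sum>w\<in>?V. g (v + w))"
    by (simp add: sum.reindex_bij_betw[OF bij_betw_digit_vec[of m], where g = "\<lambda>v. \<Sum>w\<in>?V. g (v + w)", symmetric]
        sum.reindex_bij_betw[OF bij_betw_digit_vec[of m], where g = "\<lambda>w. g (_ + w)"])
  \<comment> \<open>The factor \<open>2 ^ m\<close> from summing over pairs cancels the
    normalisation by the number of points.\<close>
  then have "gain_coeff (2 ^ m) (digital_net m C) u k = (\<Sum>d\<in>?V. g d)"
    by (simp add: gain_coeff_def factors sum_carrier_vec_add)
  also have "\<dots> = (\<Sum>d\<in>K. bit_sign (d \<bullet> b))"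
    using finV K_sub by (intro sum.mono_neutral_cong_right) (auto simp: g_def)
  also have "\<dots> = of_bool (b \<in> R) * real (card K)"
    unfolding in_R using K_sub K_add b by (rule sum_bit_sign_scalar_prod)
  finally have gain: "gain_coeff (2 ^ m) (digital_net m C) u k = of_bool (b \<in> R) * real (card K)" .
  \<comment> \<open>The row space lives in dimension \<open>m\<close>, but the rank refers to
    columns, which have length \<open>nr\<close>.\<close>
  interpret nr: vec_space "TYPE(bit)" nr .
  have "K = {d \<in> ?V. A *\<^sub>v d = 0\<^sub>v nr}"
  proof -
    have "A *\<^sub>v d = 0\<^sub>v nr \<longleftrightarrow> (\<forall>i<nr. row A i \<bullet> d = 0)" if "d \<in> ?V" for d
      using A by (auto simp: vec_eq_iff)
    then show ?thesis
      using A unfolding K_rows by (auto simp: rows_def)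
  qed
  then have "card K * 2 ^ nr.rank A = 2 ^ m"
    using nr.card_kernel_mult_card_col_space[OF finite_UNIV_bit A] nr.card_col_space[OF A]
    by (simp add: card_UNIV_bit)
  then have "real (card K) * 2 ^ nr.rank A = 2 ^ m"
    by (metis of_nat_mult of_nat_numeral of_nat_power)
  then have card_K: "real (card K) = 2 powi (int m - int (nr.rank A))"
    by (simp add: power_int_diff field_simps)
  \<comment> \<open>This separates the two possible values \<open>card K\<close> and 0, which gives
    the forward implication.\<close>
  then have "real (card K) \<noteq> 0"
    by simp
  then have "gain_coeff (2 ^ m) (digital_net m C) u k = 2 powi (int m - int (nr.rank A)) \<longleftrightarrow> b \<in> R"
    unfolding gain card_K[symmetric] by simp
  then show ?thesis
    unfolding mat_rank_def R_def b_def A_def nr_def .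
qed

end
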